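(* Let $p\ge1$, $\mathcal{X}=\mathbb{R}^{d'}$ and $\mathcal{Y}=\mathbb{R}^d$ with $d,d'\ge1$. For a Markov kernel $\rho:\mathcal{X}\to\mathcal{P}(\mathcal{Y})$ consider the conditions (CTY) $x\mapsto\rho_x$ is continuous in the narrow topology; (CRC) $x\mapsto M_p(\rho_x)$ has totally bounded sublevel sets. Then: (i) There exist $\nu\in\mathcal{P}_p(\mathcal{Y})$ and a Markov kernel $\rho$ satisfying (CRC), but not (CTY), for which no minimizer of $\sigma\mapsto W_p^p(\nu_\sigma,\nu)$ over $\mathcal{P}(\mathcal{X})$ exists. (ii) There exist $\nu\in\mathcal{P}_p(\mathcal{Y})$ and a Markov kernel $\rho$ satisfying (CTY), but not (CRC), for which no minimizer of $\sigma\mapsto W_p^p(\nu_\sigma,\nu)$ over $\mathcal{P}(\mathcal{X})$ exists.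
   Context: $\mathcal{X}=\mathbb{R}^{d'}$ carries the Euclidean metric. $\mathcal{P}(\cdot)$ denotes Borel probability measures. $M_p(\mu)=\int|y|^p\,d\mu(y)\in[0,\infty]$ and $\mathcal{P}_p(\mathcal{Y})=\{\mu\in\mathcal{P}(\mathcal{Y}):M_p(\mu)<\infty\}$. A Markov kernel $\rho:\mathcal{X}\to\mathcal{P}(\mathcal{Y})$, $x\mapsto\rho_x$, is a map such that $x\mapsto\rho_x(B)$ is Borel measurable for every Borel $B\subseteq\mathcal{Y}$. For $\sigma\in\mathcal{P}(\mathcal{X})$, $\nu_\sigma\in\mathcal{P}(\mathcal{Y})$ is defined by $\int f\,d\nu_\sigma=\int_{\mathcal{X}}\left(\int_{\mathcal{Y}}f(y)\,d\rho_x(y)\right)d\sigma(x)$ for all $f\in C_b(\mathcal{Y})$. $W_p^p(\mu_1,\mu_2)=\inf_\Gamma\int|y'-y|^p\,d\Gamma(y',y)\in[0,\infty]$, the infimum over couplings of $\mu_1,\mu_2$. Narrow topology: convergence against bounded continuous functions. A minimizer is any $\sigma_*$ attaining the infimum (also if the infimum is $+\infty$). *)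

theory Defs
  imports "HOL-Probability.Probability"
begin

abbreviation borel_probs :: "'a::topological_space measure set" where
  "borel_probs \<equiv> space (prob_algebra borel)"

definition moment :: "real \<Rightarrow> 'a::real_normed_vector measure \<Rightarrow> ennreal" where
  "moment p \<mu> = (\<integral>\<^sup>+ y. ennreal (norm y powr p) \<partial>\<mu>)"

definition borel_probs_moment :: "real \<Rightarrow> 'a::real_normed_vector measure set" where
  "borel_probs_moment p = {\<mu> \<in> borel_probs. moment p \<mu> < \<infinity>}"

definition markov_kernel :: "('a::topological_space \<Rightarrow> 'b::topological_space measure) \<Rightarrow> bool" where
  "markov_kernel \<rho> \<longleftrightarrow>
     (\<forall>x. \<rho> x \<in> borel_probs) \<and> (\<forall>B \<in> sets borel. (\<lambda>x. emeasure (\<rho> x) B) \<in> borel_measurable borel)"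

definition is_mixture ::
    "('a::topological_space \<Rightarrow> 'b::metric_space measure) \<Rightarrow> 'a measure \<Rightarrow> 'b measure \<Rightarrow> bool" where
  "is_mixture \<rho> \<sigma> \<nu> \<longleftrightarrow>
     \<nu> \<in> borel_probs \<and>
     (\<forall>f :: 'b \<Rightarrow> real. f \<in> bcontfun \<longrightarrow> (\<integral>y. f y \<partial>\<nu>) = (\<integral>x. (\<integral>y. f y \<partial>\<rho> x) \<partial>\<sigma>))"

(* Existence and uniqueness, for a Markov kernel rho and a Borel probability measure sigma, are
   shown in ex1_mixture below; mixture_eq_bind identifies the result with Giry monad bind. *)
definition mixture ::
    "('a::topological_space \<Rightarrow> 'b::metric_space measure) \<Rightarrow> 'a measure \<Rightarrow> 'b measure" where
  "mixture \<rho> \<sigma> = (THE \<nu>. is_mixture \<rho> \<sigma> \<nu>)"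

definition couplings :: "'a::topological_space measure \<Rightarrow> 'a measure \<Rightarrow> ('a \<times> 'a) measure set" where
  "couplings \<mu>\<^sub>1 \<mu>\<^sub>2 = {\<Gamma> \<in> borel_probs. distr \<Gamma> borel fst = \<mu>\<^sub>1 \<and> distr \<Gamma> borel snd = \<mu>\<^sub>2}"

(* This is the p-th power of the p-Wasserstein distance. *)
definition wasserstein_pow :: "real \<Rightarrow> 'a::real_normed_vector measure \<Rightarrow> 'a measure \<Rightarrow> ennreal" where
  "wasserstein_pow p \<mu>\<^sub>1 \<mu>\<^sub>2 =
     (INF \<Gamma> \<in> couplings \<mu>\<^sub>1 \<mu>\<^sub>2. \<integral>\<^sup>+ z. ennreal (norm (fst z - snd z) powr p) \<partial>\<Gamma>)"

(* The coarsest topology on Borel probability measures that makes integration against every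
   bounded continuous function continuous; limitin_narrow_topology describes its convergence. *)
definition narrow_topology :: "'a::topological_space measure topology" where
  "narrow_topology =
     topology_generated_by
       {{\<mu> \<in> borel_probs. (\<integral>y. f y \<partial>\<mu>) \<in> U} | (f :: 'a \<Rightarrow> real) U. f \<in> bcontfun \<and> open U}"

definition CTY :: "('a::topological_space \<Rightarrow> 'b::topological_space measure) \<Rightarrow> bool" where
  "CTY \<rho> \<longleftrightarrow> continuous_map euclidean narrow_topology \<rho>"

definition CRC :: "real \<Rightarrow> ('a::metric_space \<Rightarrow> 'b::real_normed_vector measure) \<Rightarrow> bool" where
  "CRC p \<rho> \<longleftrightarrow> (\<forall>c < \<infinity>. totally_bounded {x. moment p (\<rho> x) \<le> c})"

definition is_minimizer :: "('a \<Rightarrow> 'b::complete_lattice) \<Rightarrow> 'a set \<Rightarrow> 'a \<Rightarrow> bool" where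
  "is_minimizer F S x \<longleftrightarrow> x \<in> S \<and> F x = (INF y \<in> S. F y)"

lemma markov_kernel_iff_prob_algebra: "markov_kernel \<rho> \<longleftrightarrow> \<rho> \<in> borel \<rightarrow>\<^sub>M prob_algebra borel"
proof
  assume k: "markov_kernel \<rho>"
  show "\<rho> \<in> borel \<rightarrow>\<^sub>M prob_algebra borel"
  proof (rule measurable_prob_algebraI)
    show "prob_space (\<rho> x)" if "x \<in> space borel" for x
      using k by (auto simp: markov_kernel_def space_prob_algebra)
    show "\<rho> \<in> borel \<rightarrow>\<^sub>M subprob_algebra borel"
      using k by (intro measurable_subprob_algebra)
        (auto simp: markov_kernel_def space_prob_algebra prob_space_imp_subprob_space)
  qed
next
  assume "\<rho> \<in> borel \<rightarrow>\<^sub>M prob_algebra borel"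
  moreover from measurable_prob_algebraD[OF this]
  have "(\<lambda>x. emeasure (\<rho> x) B) \<in> borel_measurable borel" if "B \<in> sets borel" for B
    using that by (rule measurable_compose[OF _ measurable_emeasure_subprob_algebra])
  ultimately show "markov_kernel \<rho>"
    by (auto simp: markov_kernel_def dest: measurable_space)
qed

lemma borel_probs_eqI:
  fixes \<mu> \<nu> :: "'a::metric_space measure"
  assumes \<mu>: "\<mu> \<in> borel_probs" and \<nu>: "\<nu> \<in> borel_probs"
    and eq: "\<And>f :: 'a \<Rightarrow> real. f \<in> bcontfun \<Longrightarrow> (\<integral>y. f y \<partial>\<mu>) = (\<integral>y. f y \<partial>\<nu>)"
  shows "\<mu> = \<nu>"
proof -
  have lim: "(\<lambda>n. \<integral>y. max 0 (1 - real n * infdist y C) \<partial>M) \<longlonglongrightarrow> measure M C"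
    if M: "M \<in> borel_probs" and C: "closed C" "C \<noteq> {}" for M :: "'a measure" and C
  proof -
    interpret prob_space M using M by (simp add: space_prob_algebra)
    have [measurable_cong]: "sets M = sets borel" using M by (simp add: space_prob_algebra)
    have [measurable]: "C \<in> sets borel" using C by auto
    have [measurable]: "(\<lambda>y. infdist y C) \<in> borel_measurable borel"
      by (intro borel_measurable_continuous_onI continuous_intros)
    have "(\<lambda>n. \<integral>y. max 0 (1 - real n * infdist y C) \<partial>M) \<longlonglongrightarrow> (\<integral>y. indicator C y \<partial>M)"
    proof (rule integral_dominated_convergence[where w="\<lambda>_. 1"])
      show "AE y in M. (\<lambda>n. max 0 (1 - real n * infdist y C)) \<longlonglongrightarrow> indicator C y"
      proof (rule AE_I2)
        fix y
        show "(\<lambda>n. max 0 (1 - real n * infdist y C)) \<longlonglongrightarrow> indicator C y"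
        proof (cases "y \<in> C")
          case False
          then have d: "infdist y C > 0" using C by (simp add: infdist_pos_not_in_closed)
          obtain N where N: "1 < real N * infdist y C" using reals_Archimedean3[OF d] by blast
          have "max 0 (1 - real n * infdist y C) = 0" if "n \<ge> N" for n
          proof -
            have "real N * infdist y C \<le> real n * infdist y C"
              using that d by (intro mult_right_mono) auto
            with N show ?thesis by simp
          qed
          then have "eventually (\<lambda>n. max 0 (1 - real n * infdist y C) = 0) sequentially"
            unfolding eventually_sequentially by blast
          with False show ?thesis by (simp add: tendsto_eventually)
        qed simp
      qed
      show "AE y in M. norm (max 0 (1 - real n * infdist y C)) \<le> 1" for n
        by (rule AE_I2) (auto simp: infdist_nonneg)
    qed simp_all
    then show ?thesis by simp
  qed
  have bc: "(\<lambda>y. max 0 (1 - real n * infdist y C)) \<in> bcontfun" for n and C :: "'a set"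
  proof -
    have "bounded (range (\<lambda>y. max 0 (1 - real n * infdist y C)))"
      by (rule boundedI[where B=1]) (auto simp: infdist_nonneg)
    then show ?thesis by (auto simp: bcontfun_def intro!: continuous_intros)
  qed
  interpret M: prob_space \<mu> using \<mu> by (simp add: space_prob_algebra)
  interpret N: prob_space \<nu> using \<nu> by (simp add: space_prob_algebra)
  have closed_eq: "emeasure \<mu> C = emeasure \<nu> C" if "closed C" for C
  proof (cases "C = {}")
    case False
    have "measure \<mu> C = measure \<nu> C"
      using lim[OF \<mu> that False] lim[OF \<nu> that False] eq[OF bc[of _ C]]
      by (auto intro: LIMSEQ_unique)
    then show ?thesis by (simp add: M.emeasure_eq_measure N.emeasure_eq_measure)
  qed simp
  have S: "sets \<mu> = sigma_sets UNIV (Collect closed)" "sets \<nu> = sigma_sets UNIV (Collect closed)"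
    using \<mu> \<nu> by (simp_all add: space_prob_algebra borel_eq_closed)
  show ?thesis
    by (rule measure_eqI_generator_eq[where E="Collect closed" and \<Omega>=UNIV and A="\<lambda>_. UNIV"])
      (auto simp: Int_stable_def closed_eq S)
qed

lemma is_mixture_bind:
  fixes \<rho> :: "'a::topological_space \<Rightarrow> 'b::metric_space measure"
  assumes "markov_kernel \<rho>" and \<sigma>: "\<sigma> \<in> borel_probs"
  shows "is_mixture \<rho> \<sigma> (\<sigma> \<bind> \<rho>)"
proof -
  have \<rho>: "\<rho> \<in> borel \<rightarrow>\<^sub>M prob_algebra borel"
    using assms(1) by (simp add: markov_kernel_iff_prob_algebra)
  interpret prob_space \<sigma> using \<sigma> by (simp add: space_prob_algebra)
  have s: "sets \<sigma> = sets borel" using \<sigma> by (simp add: space_prob_algebra)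
  have \<rho>': "\<rho> \<in> \<sigma> \<rightarrow>\<^sub>M subprob_algebra borel"
    using measurable_prob_algebraD[OF \<rho>] by (simp add: measurable_cong_sets[OF s refl])
  have "\<sigma> \<bind> \<rho> \<in> borel_probs"
    using measurable_space[OF measurable_bind_prob_space[OF measurable_const[OF \<sigma>] \<rho>,
        where M="borel :: real measure"]]
    by simp
  moreover have "(\<integral>y. f y \<partial>(\<sigma> \<bind> \<rho>)) = (\<integral>x. (\<integral>y. f y \<partial>\<rho> x) \<partial>\<sigma>)"
    if f: "f \<in> bcontfun" for f :: "'b \<Rightarrow> real"
  proof -
    obtain B where B: "\<And>y. \<bar>f y\<bar> \<le> B"
      using f by (auto simp: bcontfun_def bounded_iff)
    have p: "prob_space (\<rho> x)" for x
      using measurable_space[OF \<rho>, of x] by (simp add: space_prob_algebra)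
    show ?thesis
      by (rule integral_bind[OF _ _ \<rho>', where B=B and B'=1])
        (use f B p in \<open>auto simp: bcontfun_def prob_space.emeasure_space_1
            intro: borel_measurable_continuous_onI finite_measure_axioms\<close>)
  qed
  ultimately show ?thesis by (auto simp: is_mixture_def)
qed

lemma is_mixture_unique: "is_mixture \<rho> \<sigma> \<mu> \<Longrightarrow> is_mixture \<rho> \<sigma> \<nu> \<Longrightarrow> \<mu> = \<nu>"
  by (auto simp: is_mixture_def intro!: borel_probs_eqI)

lemma ex1_mixture: "markov_kernel \<rho> \<Longrightarrow> \<sigma> \<in> borel_probs \<Longrightarrow> \<exists>!\<nu>. is_mixture \<rho> \<sigma> \<nu>"
  using is_mixture_bind is_mixture_unique by blast

lemma mixture_eq_bind: "markov_kernel \<rho> \<Longrightarrow> \<sigma> \<in> borel_probs \<Longrightarrow> mixture \<rho> \<sigma> = \<sigma> \<bind> \<rho>"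
  unfolding mixture_def by (rule the_equality) (blast intro: is_mixture_bind is_mixture_unique)+

lemma topspace_narrow_topology: "topspace narrow_topology = borel_probs"
proof -
  have "(\<lambda>_. 0) \<in> bcontfun" by (simp add: bcontfun_def)
  then show ?thesis
    unfolding narrow_topology_def topology_generated_by_topspace
    by (intro equalityI Union_least Union_upper) (auto intro!: exI[of _ "\<lambda>_. 0"] exI[of _ UNIV])
qed

lemma openin_narrow_topology:
  "f \<in> bcontfun \<Longrightarrow> open U \<Longrightarrow> openin narrow_topology {\<mu> \<in> borel_probs. (\<integral>y. f y \<partial>\<mu>) \<in> U}"
  for f :: "_ \<Rightarrow> real"
  unfolding narrow_topology_def by (rule topology_generated_by_Basis) blast

lemma limitin_narrow_topology:
  fixes \<mu> :: "'i \<Rightarrow> 'a::topological_space measure"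
  assumes "eventually (\<lambda>i. \<mu> i \<in> borel_probs) F" and l: "l \<in> borel_probs"
  shows "limitin narrow_topology \<mu> l F \<longleftrightarrow>
    (\<forall>f :: 'a \<Rightarrow> real. f \<in> bcontfun \<longrightarrow> ((\<lambda>i. \<integral>y. f y \<partial>\<mu> i) \<longlongrightarrow> (\<integral>y. f y \<partial>l)) F)" (is "_ \<longleftrightarrow> ?R")
proof
  assume L: "limitin narrow_topology \<mu> l F"
  show ?R
  proof (intro allI impI topological_tendstoI)
    fix f :: "'a \<Rightarrow> real" and U
    assume "f \<in> bcontfun" "open U" "(\<integral>y. f y \<partial>l) \<in> U"
    then have "eventually (\<lambda>i. \<mu> i \<in> {\<mu> \<in> borel_probs. (\<integral>y. f y \<partial>\<mu>) \<in> U}) F"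
      using L openin_narrow_topology[of f U] l unfolding limitin_def by blast
    then show "eventually (\<lambda>i. (\<integral>y. f y \<partial>\<mu> i) \<in> U) F"
      by (rule eventually_mono) simp
  qed
next
  assume R: ?R
  have "eventually (\<lambda>i. \<mu> i \<in> V) F" if "openin narrow_topology V" "l \<in> V" for V
    using that unfolding narrow_topology_def openin_topology_generated_by_iff
  proof (induction V rule: generate_topology_on.induct)
    case (Basis V)
    then obtain f :: "'a \<Rightarrow> real" and U where V: "V = {\<mu> \<in> borel_probs. (\<integral>y. f y \<partial>\<mu>) \<in> U}"
      and "f \<in> bcontfun" "open U" by blast
    with R Basis have "eventually (\<lambda>i. (\<integral>y. f y \<partial>\<mu> i) \<in> U) F"
      by (auto dest: topological_tendstoD)
    with assms(1) show ?case unfolding V by eventually_elim simp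
  next
    case (UN K)
    then obtain k where "k \<in> K" "l \<in> k" by blast
    with UN.IH have "eventually (\<lambda>i. \<mu> i \<in> k) F" by blast
    then show ?case using \<open>k \<in> K\<close> by (auto elim: eventually_mono)
  qed (auto intro: eventually_conj)
  then show "limitin narrow_topology \<mu> l F"
    using l by (simp add: limitin_def topspace_narrow_topology)
qed

end

(* Take nu = delta_0 and rho_x = delta_(g x) with g nowhere zero. Then W_p^p(nu_sigma, delta_0) is
   the integral of |g|^p against sigma, which is always positive, while its infimum is 0 as soon as
   |g| takes arbitrarily small values. A jump at the point where |g| would vanish violates only
   (CTY); letting |g| decay continuously at infinity violates only (CRC). *)
theory Submission
  imports Defs
begin

lemma return_in_borel_probs: "return borel x \<in> borel_probs"
  by (simp add: space_prob_algebra prob_space_return)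

lemma moment_return: "moment p (return borel y) = ennreal (norm y powr p)"
  by (simp add: moment_def nn_integral_return)

text \<open>Every coupling with the point mass at 0 is concentrated on pairs with second component
  0, so all couplings have the same cost. It remains to exhibit one, since an infimum over the empty
  set would be infinite.\<close>

lemma wasserstein_pow_return_zero:
  fixes \<mu> :: "'a::real_normed_vector measure"
  assumes \<mu>: "\<mu> \<in> borel_probs"
  shows "wasserstein_pow p \<mu> (return borel 0) = moment p \<mu>"
proof -
  interpret prob_space \<mu> using \<mu> by (simp add: space_prob_algebra)
  have s [measurable_cong]: "sets \<mu> = sets borel" using \<mu> by (simp add: space_prob_algebra)
  \<comment> \<open>Separability of \<open>'a\<close> is not assumed, so the Borel sets of
    \<open>'a \<times> 'a\<close> may exceed the product sigma-algebra. Measurability is therefore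
    taken from continuity.\<close>
  have [measurable]: "(fst :: 'a \<times> 'a \<Rightarrow> 'a) \<in> borel \<rightarrow>\<^sub>M borel" "(snd :: 'a \<times> 'a \<Rightarrow> 'a) \<in> borel \<rightarrow>\<^sub>M borel"
    "(\<lambda>y::'a. (y, 0::'a)) \<in> borel \<rightarrow>\<^sub>M borel"
    by (intro borel_measurable_continuous_onI continuous_intros)+
  have [measurable]: "(\<lambda>z::'a \<times> 'a. fst z - snd z) \<in> borel \<rightarrow>\<^sub>M borel"
    by (intro borel_measurable_continuous_onI continuous_intros)
  show ?thesis
  proof (rule antisym)
    \<comment> \<open>The plan that transports all mass to the origin.\<close>
    let ?\<Gamma> = "distr \<mu> borel (\<lambda>y. (y, 0::'a))"
    have "distr ?\<Gamma> borel snd = return borel 0"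
    proof (rule measure_eqI)
      fix A assume "A \<in> sets (distr ?\<Gamma> borel snd)"
      then have [measurable]: "A \<in> sets borel" by simp
      show "emeasure (distr ?\<Gamma> borel snd) A = emeasure (return borel 0) A"
        using emeasure_space_1
        by (auto simp: distr_distr comp_def emeasure_distr indicator_def)
    qed simp
    moreover have "distr ?\<Gamma> borel fst = \<mu>"
      using distr_id2[OF s[symmetric]] by (simp add: distr_distr comp_def)
    moreover have "?\<Gamma> \<in> borel_probs"
      by (simp add: space_prob_algebra prob_space_distr)
    ultimately have "?\<Gamma> \<in> couplings \<mu> (return borel 0)"
      by (simp add: couplings_def)
    then show "wasserstein_pow p \<mu> (return borel 0) \<le> moment p \<mu>"
      unfolding wasserstein_pow_def moment_def
      by (rule INF_lower2) (simp add: nn_integral_distr)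
  next
    show "moment p \<mu> \<le> wasserstein_pow p \<mu> (return borel 0)"
      unfolding wasserstein_pow_def
    proof (rule INF_greatest)
      fix \<Gamma> assume "\<Gamma> \<in> couplings \<mu> (return borel (0::'a))"
      then have [measurable_cong]: "sets \<Gamma> = sets borel"
        and fst: "distr \<Gamma> borel fst = \<mu>" and snd: "distr \<Gamma> borel snd = return borel 0"
        by (auto simp: couplings_def space_prob_algebra)
      \<comment> \<open>Pulling this back along \<open>snd\<close> reduces the cost to
        \<open>norm (fst z) powr p\<close>, which only the first marginal determines.\<close>
      have "AE y in distr \<Gamma> borel snd. y = 0"
        unfolding snd by (subst AE_return) auto
      then have "AE z in \<Gamma>. snd z = 0"
        by (subst (asm) AE_distr_iff) auto
      then have "(\<integral>\<^sup>+ z. ennreal (norm (fst z - snd z) powr p) \<partial>\<Gamma>) =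
          (\<integral>\<^sup>+ z. ennreal (norm (fst z) powr p) \<partial>\<Gamma>)"
        by (intro nn_integral_cong_AE) auto
      also have "\<dots> = moment p (distr \<Gamma> borel fst)"
        unfolding moment_def by (simp add: nn_integral_distr)
      finally show "moment p \<mu> \<le> (\<integral>\<^sup>+ z. ennreal (norm (fst z - snd z) powr p) \<partial>\<Gamma>)"
        unfolding fst by simp
    qed
  qed
qed

lemma markov_kernel_return:
  assumes "g \<in> borel_measurable borel"
  shows "markov_kernel (\<lambda>x. return borel (g x))"
  using assms unfolding markov_kernel_iff_prob_algebra
  by (intro measurable_prob_algebraI measurable_compose[OF assms return_measurable])
    (auto simp: prob_space_return)

lemma mixture_return:
  assumes g: "g \<in> borel_measurable borel" and \<sigma>: "\<sigma> \<in> borel_probs"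
  shows "mixture (\<lambda>x. return borel (g x)) \<sigma> = distr \<sigma> borel g"
proof -
  have s [measurable_cong]: "sets \<sigma> = sets borel" using \<sigma> by (simp add: space_prob_algebra)
  \<comment> \<open>Over an empty space the Giry bind is a default value; excluding that case turns
    bind with \<open>return\<close> into a push-forward.\<close>
  have "space \<sigma> \<noteq> {}" using \<sigma> by (auto simp: space_prob_algebra prob_space.not_empty)
  then show ?thesis
    using g by (simp add: mixture_eq_bind[OF markov_kernel_return[OF g] \<sigma>] bind_return_distr'
        measurable_cong_sets[OF s refl])
qed

text \<open>Integrating \<open>f\<close> against the point mass at \<open>g x\<close> gives
  \<open>f (g x)\<close>. Narrow continuity thus means that \<open>f \<circ> g\<close> is continuous
  for every bounded continuous \<open>f\<close>, and truncated distances suffice to recover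
  continuity of \<open>g\<close>.\<close>

lemma CTY_return_iff:
  fixes g :: "'a::topological_space \<Rightarrow> 'b::metric_space"
  shows "CTY (\<lambda>x. return borel (g x)) \<longleftrightarrow> continuous_on UNIV g"
proof
  assume C: "CTY (\<lambda>x. return borel (g x))"
  have "(g \<longlongrightarrow> g a) (at a)" for a
  proof (rule tendstoI)
    fix e :: real assume "e > 0"
    \<comment> \<open>Truncation makes the distance an admissible test function. Below the threshold
      \<open>min 1 e\<close> used next, the truncation is inactive and \<open>f\<close> is the
      distance itself.\<close>
    define f where "f y = min 1 (dist y (g a))" for y
    have cont: "continuous_on UNIV f"
      unfolding f_def by (intro continuous_intros)
    have "bounded (range f)"
      by (rule boundedI[where B=1]) (auto simp: f_def)
    with cont have "f \<in> bcontfun" by (simp add: bcontfun_def)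
    from openin_narrow_topology[OF this, of "{..<min 1 e}"]
    have "open ((\<lambda>x. return borel (g x)) -` {\<mu> \<in> borel_probs. (\<integral>y. f y \<partial>\<mu>) < min 1 e})"
      using C by (auto simp: CTY_def continuous_map_alt)
    also have "(\<lambda>x. return borel (g x)) -` {\<mu> \<in> borel_probs. (\<integral>y. f y \<partial>\<mu>) < min 1 e} =
        {x. f (g x) < min 1 e}"
      using borel_measurable_continuous_onI[OF cont]
      by (auto simp: return_in_borel_probs integral_return)
    finally have "\<forall>\<^sub>F x in at a. x \<in> {x. f (g x) < min 1 e}"
      by (rule eventually_at_in_open') (use \<open>e > 0\<close> in \<open>simp add: f_def\<close>)
    then show "\<forall>\<^sub>F x in at a. dist (g x) (g a) < e"
      by (rule eventually_mono) (auto simp: f_def min_def split: if_splits)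
  qed
  then show "continuous_on UNIV g" by (simp add: continuous_on_def)
next
  assume g: "continuous_on UNIV g"
  have "open ((\<lambda>x. return borel (g x)) -` {\<mu> \<in> borel_probs. (\<integral>y. f y \<partial>\<mu>) \<in> U})"
    if f: "f \<in> bcontfun" and "open U" for f :: "'b \<Rightarrow> real" and U
  proof -
    have cont: "continuous_on UNIV f" using f by (simp add: bcontfun_def)
    have "(\<lambda>x. return borel (g x)) -` {\<mu> \<in> borel_probs. (\<integral>y. f y \<partial>\<mu>) \<in> U} = (f \<circ> g) -` U"
      using borel_measurable_continuous_onI[OF cont]
      by (auto simp: return_in_borel_probs integral_return)
    moreover have "continuous_on UNIV (f \<circ> g)"
      using g cont by (meson continuous_on_compose continuous_on_subset subset_UNIV)
    ultimately show ?thesis using \<open>open U\<close> by (metis open_vimage)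
  qed
  then show "CTY (\<lambda>x. return borel (g x))"
    unfolding CTY_def narrow_topology_def
    by (intro continuous_on_generated_topo)
      (auto simp: return_in_borel_probs topspace_narrow_topology[unfolded narrow_topology_def
          topology_generated_by_topspace])
qed

text \<open>Finitely many unit balls form a bounded set; conversely, the closure of a bounded set is
  compact by Heine-Borel. This reduces \<open>CRC\<close> to boundedness of sublevel sets.\<close>

lemma totally_bounded_iff_bounded:
  fixes S :: "'a::heine_borel set"
  shows "totally_bounded S \<longleftrightarrow> bounded S"
proof
  assume "totally_bounded S"
  then obtain K where "finite K" "S \<subseteq> (\<Union>x\<in>K. ball x 1)"
    unfolding totally_bounded_metric ball_def using zero_less_one by blast
  moreover from this have "bounded (\<Union>x\<in>K. ball x 1)" by blast
  ultimately show "bounded S" using bounded_subset by blast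
next
  assume "bounded S"
  then have "compact (closure S)" by simp
  then have "totally_bounded (closure S)"
    by (simp add: compact_eq_totally_bounded totally_bounded_metric ball_def)
  then show "totally_bounded S" by (rule totally_bounded_subset) (rule closure_subset)
qed

text \<open>Point masses where \<open>g\<close> is small push the infimum to 0, and the value 0
  would force \<open>g\<close> to vanish almost everywhere.\<close>

lemma no_minimizer_return:
  fixes g :: "'a::topological_space \<Rightarrow> 'b::real_normed_vector"
  assumes g [measurable]: "g \<in> borel_measurable borel" and nz: "\<And>x. g x \<noteq> 0"
    and small: "\<And>\<epsilon>. \<epsilon> > 0 \<Longrightarrow> \<exists>x. norm (g x) < \<epsilon>" and "p > 0"
  shows "\<not> is_minimizer
    (\<lambda>\<sigma>. wasserstein_pow p (mixture (\<lambda>x. return borel (g x)) \<sigma>) (return borel 0)) borel_probs \<sigma>"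
proof
  let ?F = "\<lambda>\<sigma>. wasserstein_pow p (mixture (\<lambda>x. return borel (g x)) \<sigma>) (return borel 0)"
  assume min: "is_minimizer ?F borel_probs \<sigma>"
  have F: "?F \<tau> = (\<integral>\<^sup>+ x. ennreal (norm (g x) powr p) \<partial>\<tau>)" if \<tau>: "\<tau> \<in> borel_probs" for \<tau>
  proof -
    interpret prob_space \<tau> using \<tau> by (simp add: space_prob_algebra)
    have [measurable_cong]: "sets \<tau> = sets borel" using \<tau> by (simp add: space_prob_algebra)
    have "distr \<tau> borel g \<in> borel_probs"
      by (simp add: space_prob_algebra prob_space_distr)
    then show ?thesis
      by (simp add: mixture_return[OF g \<tau>] wasserstein_pow_return_zero moment_def nn_integral_distr)
  qed
  from min have \<sigma>: "\<sigma> \<in> borel_probs" by (simp add: is_minimizer_def)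
  interpret prob_space \<sigma> using \<sigma> by (simp add: space_prob_algebra)
  have [measurable_cong]: "sets \<sigma> = sets borel" using \<sigma> by (simp add: space_prob_algebra)
  have "?F \<sigma> \<le> ennreal \<epsilon>" if "\<epsilon> > 0" for \<epsilon>
  proof -
    \<comment> \<open>The \<open>p\<close>-th root is taken so that the cost at \<open>x\<close> is
      at most \<open>\<epsilon>\<close>.\<close>
    obtain x where x: "norm (g x) < \<epsilon> powr (1 / p)" using small[of "\<epsilon> powr (1 / p)"] \<open>\<epsilon> > 0\<close> by auto
    have "?F \<sigma> \<le> ?F (return borel x)"
      using min return_in_borel_probs[of x] by (auto simp: is_minimizer_def intro: INF_lower)
    also have "\<dots> = ennreal (norm (g x) powr p)"
      by (simp add: F return_in_borel_probs nn_integral_return)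
    also have "\<dots> \<le> ennreal ((\<epsilon> powr (1 / p)) powr p)"
      using x \<open>p > 0\<close> by (intro ennreal_leI powr_mono2) auto
    finally show ?thesis using \<open>p > 0\<close> \<open>\<epsilon> > 0\<close> by (simp add: powr_powr)
  qed
  then have "?F \<sigma> = 0"
    by (metis ennreal_le_epsilon add_0 le_zero_eq)
  then have "AE x in \<sigma>. ennreal (norm (g x) powr p) = 0"
    unfolding F[OF \<sigma>] by (subst (asm) nn_integral_0_iff_AE) auto
  then have "AE x in \<sigma>. False"
    by eventually_elim (use nz in \<open>simp add: ennreal_eq_0_iff\<close>)
  then show False by simp
qed

theorem proposition2p3:
  fixes p :: real
  assumes "p \<ge> 1"
  shows
    "(\<exists>(\<nu> :: (real ^ 'd) measure) (\<rho> :: real ^ 'e \<Rightarrow> (real ^ 'd) measure).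
        \<nu> \<in> borel_probs_moment p \<and> markov_kernel \<rho> \<and> CRC p \<rho> \<and> \<not> CTY \<rho> \<and>
        (\<nexists>\<sigma>. is_minimizer (\<lambda>\<sigma>. wasserstein_pow p (mixture \<rho> \<sigma>) \<nu>) borel_probs \<sigma>)) \<and>
     (\<exists>(\<nu> :: (real ^ 'd) measure) (\<rho> :: real ^ 'e \<Rightarrow> (real ^ 'd) measure).
        \<nu> \<in> borel_probs_moment p \<and> markov_kernel \<rho> \<and> CTY \<rho> \<and> \<not> CRC p \<rho> \<and>
        (\<nexists>\<sigma>. is_minimizer (\<lambda>\<sigma>. wasserstein_pow p (mixture \<rho> \<sigma>) \<nu>) borel_probs \<sigma>))"
proof -
  \<comment> \<open>Unit vectors exist because index types are nonempty, that is, both dimensions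
    are at least 1.\<close>
  obtain e :: "real ^ 'd" where e: "norm e = 1"
    using vector_choose_size[of 1] by auto
  obtain u :: "real ^ 'e" where u: "norm u = 1"
    using vector_choose_size[of 1] by auto
  have "return borel (0 :: real ^ 'd) \<in> borel_probs_moment p"
    by (simp add: borel_probs_moment_def return_in_borel_probs moment_return)
  moreover
  \<comment> \<open>The value at the origin removes the only zero of
    \<open>norm x *\<^sub>R e\<close> at the price of a jump; growth at infinity keeps sublevel sets
    bounded.\<close>
  define g :: "real ^ 'e \<Rightarrow> real ^ 'd" where "g x = (if x = 0 then 1 else norm x) *\<^sub>R e" for x
  define h :: "real ^ 'e \<Rightarrow> real ^ 'd" where "h x = exp (- norm x) *\<^sub>R e" for x
  have "e \<noteq> 0" using e by auto
  have gm: "g \<in> borel_measurable borel"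
    unfolding g_def by measurable
  have hc: "continuous_on UNIV h"
    unfolding h_def by (intro continuous_intros)
  have "CRC p (\<lambda>x. return borel (g x))"
    unfolding CRC_def
  proof (intro allI impI)
    fix c :: ennreal assume "c < \<infinity>"
    then obtain r where r: "c = ennreal r" "r \<ge> 0" by (cases c) auto
    have "norm x \<le> r powr (1 / p)" if "moment p (return borel (g x)) \<le> c" for x
    proof (cases "x = 0")
      case False
      with that r e have "norm x powr p \<le> r" by (simp add: moment_return g_def)
      then have "(norm x powr p) powr (1 / p) \<le> r powr (1 / p)"
        using assms by (intro powr_mono2) auto
      then show ?thesis using assms by (simp add: powr_powr)
    qed simp
    then have "bounded {x. moment p (return borel (g x)) \<le> c}"
      by (auto simp: bounded_iff)
    then show "totally_bounded {x. moment p (return borel (g x)) \<le> c}"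
      by (simp add: totally_bounded_iff_bounded)
  qed
  moreover have "\<not> CTY (\<lambda>x. return borel (g x))"
  proof
    assume "CTY (\<lambda>x. return borel (g x))"
    then have "(g \<longlongrightarrow> g 0) (at 0)" by (simp add: CTY_return_iff continuous_on_def)
    \<comment> \<open>Off the origin \<open>g\<close> agrees with this continuous map, so its limit
      at 0 is 0, whereas \<open>g 0 = e\<close>.\<close>
    moreover have "((\<lambda>x::real ^ 'e. norm x *\<^sub>R e) \<longlongrightarrow> norm (0 :: real ^ 'e) *\<^sub>R e) (at 0)"
      by (intro tendsto_intros)
    then have "(g \<longlongrightarrow> 0) (at 0)"
      by (rule Lim_transform_eventually[THEN tendsto_eq_rhs]) (auto simp: g_def eventually_at_filter)
    ultimately have "g 0 = 0" by (rule tendsto_unique[rotated]) simp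
    then show False using \<open>e \<noteq> 0\<close> by (simp add: g_def)
  qed
  moreover have "\<exists>x. norm (g x) < \<epsilon>" if "\<epsilon> > 0" for \<epsilon>
    \<comment> \<open>The point is nonzero, hence avoids the exceptional value, and has norm
      \<open>\<epsilon> / 2\<close>.\<close>
    using that u e by (intro exI[of _ "(\<epsilon> / 2) *\<^sub>R u"]) (auto simp: g_def)
  then have "\<nexists>\<sigma>. is_minimizer
      (\<lambda>\<sigma>. wasserstein_pow p (mixture (\<lambda>x. return borel (g x)) \<sigma>) (return borel 0)) borel_probs \<sigma>"
    using gm assms \<open>e \<noteq> 0\<close> no_minimizer_return[of g p] by (auto simp: g_def)
  moreover have "\<not> CRC p (\<lambda>x. return borel (h x))"
  proof
    assume "CRC p (\<lambda>x. return borel (h x))"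
    \<comment> \<open>The sublevel set at level 1 is thus the whole space, which is
      unbounded.\<close>
    moreover have "moment p (return borel (h x)) \<le> 1" for x
      using e assms by (simp add: moment_return h_def powr_le1)
    ultimately have "totally_bounded (UNIV :: (real ^ 'e) set)"
      by (auto simp: CRC_def dest: spec[of _ 1])
    then show False by (simp add: totally_bounded_iff_bounded)
  qed
  moreover have "\<exists>x. norm (h x) < \<epsilon>" if "\<epsilon> > 0" for \<epsilon>
  proof -
    \<comment> \<open>The absolute value makes the coefficient of \<open>u\<close> nonnegative,
      hence equal to the norm of the point, also when \<open>\<epsilon> > 1\<close>; the summand 1
      makes the bound strict.\<close>
    have "norm (h ((\<bar>ln \<epsilon>\<bar> + 1) *\<^sub>R u)) = exp (- \<bar>ln \<epsilon>\<bar> - 1)"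
      using u e by (simp add: h_def)
    also have "\<dots> < exp (ln \<epsilon>)" by simp
    finally show ?thesis using that by auto
  qed
  then have "\<nexists>\<sigma>. is_minimizer
      (\<lambda>\<sigma>. wasserstein_pow p (mixture (\<lambda>x. return borel (h x)) \<sigma>) (return borel 0)) borel_probs \<sigma>"
    using borel_measurable_continuous_onI[OF hc] assms \<open>e \<noteq> 0\<close> no_minimizer_return[of h p]
    by (auto simp: h_def)
  ultimately show ?thesis
    using markov_kernel_return[OF gm] markov_kernel_return[OF borel_measurable_continuous_onI[OF hc]]
      hc[folded CTY_return_iff]
    by blast
qed

end
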